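(* For a set $A\subseteq\omega$ the following conditions are equivalent. (1) There is an SDNR function $f_1\le_{T}A$. (2) For every recursive function $g$ there is a function $f_2\le_{T}A$ such that for all recursive functions $h$ with $|W_{h(n)}|<g(n)$ for all $n$, we have $f_2(n)\notin W_{h(n)}$ for all but finitely many $n$. (3) There is a function $f_3\le_{T}A$ such that for every partial recursive function $V$ taking inputs from $\{0,1\}^*$ and for almost all $n$, $f_3(n)\notin\{V(p): p\in\{0,1\}^*,\ |p|<n,\ V(p)\text{ is defined}\}$. (4) There is a function $f_4\le_{T}A$ with $C(f_4(n))\ge n$ for all $n$. (5) There is a DNR function $f_5\le_{T}A$. (6) $A$ is autocomplex.
   Context: Fix an acceptable numbering $\varphi_0,\varphi_1,\dots$ of the partial recursive functions, and let $W_n$ be the $n$th recursively enumerable set. $C$ denotes plain Kolmogorov complexity with respect to a fixed universal machine on binary strings; natural numbers and binary strings are identified in a standard computable way. $A\upharpoonright y$ is the binary string $A(0)\ldots A(y-1)$. A set $A$ is autocomplex if there is an $A$-recursive, nondecreasing, unbounded function $g:\omega\to\omega$ with $C(A\upharpoonright y)\ge g(y)$ for all $y$. A total function $f:\omega\to\omega$ is diagonally nonrecursive (DNR) if $f(x)\neq\varphi_x(x)$ for every $x$ with $\varphi_x(x)$ defined. It is strongly DNR (SDNR) if for all $x$ and all $y\le x$, $f(x)\ne\varphi_y(y)$ whenever $\varphi_y(y)$ is defined. *)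

theory Defs
  imports Main "HOL-Library.Nat_Bijection"
begin

section \<open>Relative recursiveness\<close>

text \<open>
  Partial functions are maps \<^typ>\<open>nat \<Rightarrow> nat option\<close>, with \<^const>\<open>None\<close> for ``undefined''.
  As usual for unary presentations of the \<open>\<mu>\<close>-recursive functions, the several arguments of a function
  are packed into one number by the Cantor pairing \<^const>\<open>prod_encode\<close>, whose projections are
  therefore taken as initial functions.
\<close>

definition prim_rec :: "(nat \<Rightarrow> nat option) \<Rightarrow> (nat \<Rightarrow> nat option) \<Rightarrow> nat \<Rightarrow> nat option" where
  "prim_rec f g n =
     (case prod_decode n of (a, m) \<Rightarrow>
        rec_nat (f a) (\<lambda>y r. Option.bind r (\<lambda>i. g (prod_encode (a, prod_encode (y, i))))) m)"

text \<open>Unbounded search diverges if it meets an undefined value before the first zero.\<close>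

definition minimize :: "(nat \<Rightarrow> nat option) \<Rightarrow> nat \<Rightarrow> nat option" where
  "minimize f a =
     (if \<exists>n. f (prod_encode (a, n)) = Some 0 \<and> (\<forall>m<n. f (prod_encode (a, m)) \<noteq> None)
      then Some (LEAST n. f (prod_encode (a, n)) = Some 0)
      else None)"

text \<open>\<open>partrec_in \<O> f\<close>: the function \<open>f\<close> is partial recursive relative to the total functions in \<open>\<O>\<close>.\<close>

inductive partrec_in :: "(nat \<Rightarrow> nat) set \<Rightarrow> (nat \<Rightarrow> nat option) \<Rightarrow> bool" for \<O> where
  zero: "partrec_in \<O> (\<lambda>_. Some 0)"
| succ: "partrec_in \<O> (\<lambda>n. Some (Suc n))"
| left: "partrec_in \<O> (\<lambda>n. Some (fst (prod_decode n)))"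
| right: "partrec_in \<O> (\<lambda>n. Some (snd (prod_decode n)))"
| orac: "q \<in> \<O> \<Longrightarrow> partrec_in \<O> (\<lambda>n. Some (q n))"
| pair: "partrec_in \<O> f \<Longrightarrow> partrec_in \<O> g \<Longrightarrow>
    partrec_in \<O> (\<lambda>n. Option.bind (f n) (\<lambda>a. Option.bind (g n) (\<lambda>b. Some (prod_encode (a, b)))))"
| comp: "partrec_in \<O> f \<Longrightarrow> partrec_in \<O> g \<Longrightarrow> partrec_in \<O> (\<lambda>n. Option.bind (g n) f)"
| prec: "partrec_in \<O> f \<Longrightarrow> partrec_in \<O> g \<Longrightarrow> partrec_in \<O> (prim_rec f g)"
| search: "partrec_in \<O> f \<Longrightarrow> partrec_in \<O> (minimize f)"

definition partial_recursive :: "(nat \<Rightarrow> nat option) \<Rightarrow> bool" where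
  "partial_recursive f \<longleftrightarrow> partrec_in {} f"

definition partial_recursive2 :: "(nat \<Rightarrow> nat \<Rightarrow> nat option) \<Rightarrow> bool" where
  "partial_recursive2 f \<longleftrightarrow> partial_recursive (\<lambda>n. case prod_decode n of (x, y) \<Rightarrow> f x y)"

definition recursive :: "(nat \<Rightarrow> nat) \<Rightarrow> bool" where
  "recursive f \<longleftrightarrow> partial_recursive (\<lambda>n. Some (f n))"

definition turing_le :: "(nat \<Rightarrow> nat) \<Rightarrow> nat set \<Rightarrow> bool"  (infix "\<le>\<^sub>T" 50) where
  "f \<le>\<^sub>T A \<longleftrightarrow> partrec_in {\<lambda>n. if n \<in> A then 1 else 0} (\<lambda>n. Some (f n))"

section \<open>Numberings and diagonally nonrecursive functions\<close>

text \<open>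
  Acceptability is stated as universality together with the parametrization (s-m-n) property.
  The latter also yields that every partial recursive function occurs in the numbering.
\<close>

definition acceptable_numbering :: "(nat \<Rightarrow> nat \<Rightarrow> nat option) \<Rightarrow> bool" where
  "acceptable_numbering \<phi> \<longleftrightarrow>
     partial_recursive2 \<phi> \<and>
     (\<forall>\<psi>. partial_recursive2 \<psi> \<longrightarrow> (\<exists>s. recursive s \<and> (\<forall>e. \<phi> (s e) = \<psi> e)))"

definition W :: "(nat \<Rightarrow> nat \<Rightarrow> nat option) \<Rightarrow> nat \<Rightarrow> nat set" where
  "W \<phi> e = dom (\<phi> e)"

definition DNR :: "(nat \<Rightarrow> nat \<Rightarrow> nat option) \<Rightarrow> (nat \<Rightarrow> nat) \<Rightarrow> bool" where
  "DNR \<phi> f \<longleftrightarrow> (\<forall>x v. \<phi> x x = Some v \<longrightarrow> f x \<noteq> v)"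

definition SDNR :: "(nat \<Rightarrow> nat \<Rightarrow> nat option) \<Rightarrow> (nat \<Rightarrow> nat) \<Rightarrow> bool" where
  "SDNR \<phi> f \<longleftrightarrow> (\<forall>x. \<forall>y\<le>x. \<forall>v. \<phi> y y = Some v \<longrightarrow> f x \<noteq> v)"

section \<open>Binary strings and plain Kolmogorov complexity\<close>

text \<open>
  The length-lexicographic identification: the string \<open>w\<close> corresponds to the number \<open>n\<close> for which
  \<open>1w\<close> is the binary expansion of \<open>n + 1\<close>, most significant digit first.
\<close>

definition num_of_str :: "bool list \<Rightarrow> nat" where
  "num_of_str w = foldl (\<lambda>n b. 2 * n + (if b then 2 else 1)) 0 w"

definition str_of_num :: "nat \<Rightarrow> bool list" where
  "str_of_num = inv num_of_str"

lemma num_of_str_snoc: "num_of_str (w @ [b]) = 2 * num_of_str w + (if b then 2 else 1)"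
  by (simp add: num_of_str_def)

lemma bij_num_of_str: "bij num_of_str"
proof (rule bijI)
  show "inj num_of_str"
  proof (rule injI)
    fix v w :: "bool list"
    assume "num_of_str v = num_of_str w"
    then show "v = w"
    proof (induction v arbitrary: w rule: rev_induct)
      case Nil
      then show ?case
        by (cases w rule: rev_cases) (auto simp: num_of_str_snoc num_of_str_def split: if_splits)
    next
      case (snoc b v)
      show ?case
      proof (cases w rule: rev_cases)
        case Nil
        with snoc.prems show ?thesis
          by (auto simp: num_of_str_snoc) (auto simp: num_of_str_def split: if_splits)
      next
        case (snoc w' c)
        with snoc.prems have eq: "2 * num_of_str v + (if b then 2 else 1) =
            2 * num_of_str w' + (if c then 2 else 1)"
          by (simp add: num_of_str_snoc)
        then have "b = c" by (cases b; cases c; simp; presburger)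
        with eq have "num_of_str v = num_of_str w'" by simp
        with snoc.IH \<open>b = c\<close> snoc show ?thesis by simp
      qed
    qed
  qed
  have "\<exists>w. num_of_str w = n" for n
  proof (induction n rule: less_induct)
    case (less n)
    show ?case
    proof (cases "n = 0")
      case True
      then have "num_of_str [] = n" by (simp add: num_of_str_def)
      then show ?thesis ..
    next
      case False
      then have "(n - 1) div 2 < n" by linarith
      then obtain w where w: "num_of_str w = (n - 1) div 2"
        using less.IH by blast
      have "num_of_str (w @ [even n]) = n"
        unfolding num_of_str_snoc w using False by (cases "even n") (auto elim!: evenE oddE)
      then show ?thesis ..
    qed
  qed
  then show "surj num_of_str" by (metis surjI)
qed

definition partial_recursive_str_num :: "(bool list \<Rightarrow> nat option) \<Rightarrow> bool" where
  "partial_recursive_str_num V \<longleftrightarrow> partial_recursive (\<lambda>n. V (str_of_num n))"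

definition machine :: "(bool list \<Rightarrow> bool list option) \<Rightarrow> bool" where
  "machine M \<longleftrightarrow> partial_recursive (\<lambda>n. map_option num_of_str (M (str_of_num n)))"

text \<open>
  Universality is required only in the weak sense of additive optimality; it is implied by
  simulation through a prefix, \<open>U (w @ p) = M p\<close> for a string \<open>w\<close> depending on \<open>M\<close>.
\<close>

definition universal_machine :: "(bool list \<Rightarrow> bool list option) \<Rightarrow> bool" where
  "universal_machine U \<longleftrightarrow>
     machine U \<and>
     (\<forall>M. machine M \<longrightarrow>
        (\<exists>c. \<forall>p x. M p = Some x \<longrightarrow> (\<exists>q. U q = Some x \<and> length q \<le> length p + c)))"

text \<open>If \<open>U\<close> is universal then every string has a \<open>U\<close>-description, so the least length exists.\<close>

definition C :: "(bool list \<Rightarrow> bool list option) \<Rightarrow> bool list \<Rightarrow> nat" where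
  "C U x = (LEAST k. \<exists>p. U p = Some x \<and> length p = k)"

definition initial_segment :: "nat set \<Rightarrow> nat \<Rightarrow> bool list"  (infix "\<restriction>" 80) where
  "A \<restriction> y = map (\<lambda>n. n \<in> A) [0..<y]"

definition autocomplex :: "(bool list \<Rightarrow> bool list option) \<Rightarrow> nat set \<Rightarrow> bool" where
  "autocomplex U A \<longleftrightarrow>
     (\<exists>g. g \<le>\<^sub>T A \<and> mono g \<and> (\<forall>b. \<exists>y. g y > b) \<and> (\<forall>y. C U (A \<restriction> y) \<ge> g y))"

end

theory Submission
  imports Defs
begin

text \<open>
  Everything is derived from a DNR function \<open>f\<close>. By the s-m-n theorem, finitely many values
  \<open>\<psi> (n, 0), \<dots>, \<psi> (n, k - 1)\<close> of a partial recursive \<open>\<psi>\<close> are avoided simultaneously by a code of a \<open>k\<close>-tuple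
  whose entry \<open>i\<close> is a value of \<open>f\<close> diagonalizing against entry \<open>i\<close> of \<open>\<psi> (n, i)\<close>. Applied to a universal
  function this gives one \<open>h\<close> recursive in \<open>f\<close> that, for every partial recursive \<open>\<psi>\<close> and almost all \<open>n\<close>,
  avoids \<open>\<psi> (n, i)\<close> for all \<open>i < b n\<close>. Choosing \<open>\<psi>\<close> suitably yields (1), (2), (3) and (6); for (6), an
  initial segment of \<open>A\<close> long enough to compute \<open>h n\<close> cannot have a description shorter than \<open>n\<close>.
  Conversely, (1), (2), (3) and (4) give DNR functions
  directly, and (6) gives (4) because the first initial segment whose complexity
  is certified by the lower bound to be at least \<open>n\<close> can be found recursively in \<open>A\<close>.
\<close>

section \<open>Closure properties of relative recursiveness\<close>

definition computable_in :: "(nat \<Rightarrow> nat) set \<Rightarrow> (nat \<Rightarrow> nat) \<Rightarrow> bool" where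
  "computable_in \<O> f \<longleftrightarrow> partrec_in \<O> (\<lambda>x. Some (f x))"

definition decidable_in :: "(nat \<Rightarrow> nat) set \<Rightarrow> (nat \<Rightarrow> bool) \<Rightarrow> bool" where
  "decidable_in \<O> P \<longleftrightarrow> computable_in \<O> (\<lambda>x. if P x then 1 else 0)"

abbreviation pr1 :: "nat \<Rightarrow> nat" where "pr1 z \<equiv> fst (prod_decode z)"
abbreviation pr2 :: "nat \<Rightarrow> nat" where "pr2 z \<equiv> snd (prod_decode z)"

named_theorems rec_intros

lemma partrec_in_mono:
  assumes "partrec_in \<O> f" and "\<O> \<subseteq> \<O>'"
  shows "partrec_in \<O>' f"
  using assms(1)
proof induction
  case (orac q)
  then show ?case using assms(2) by (auto intro: partrec_in.orac)
qed (auto intro: partrec_in.intros)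

lemma computable_in_mono:
  "computable_in {} f \<Longrightarrow> computable_in \<O> f"
  unfolding computable_in_def by (rule partrec_in_mono) auto

lemma partrec_in_comp:
  "partrec_in \<O> f \<Longrightarrow> computable_in \<O> g \<Longrightarrow> partrec_in \<O> (\<lambda>x. f (g x))"
  unfolding computable_in_def by (drule partrec_in.comp, assumption) simp

lemma computable_in_comp:
  "computable_in \<O> f \<Longrightarrow> computable_in \<O> g \<Longrightarrow> computable_in \<O> (\<lambda>x. f (g x))"
  unfolding computable_in_def[of _ f] by (drule partrec_in_comp) (simp_all add: computable_in_def)

lemma computable_in_oracle:
  "q \<in> \<O> \<Longrightarrow> computable_in \<O> q"
  unfolding computable_in_def by (rule partrec_in.orac)

lemma computable_in_prod_encode [rec_intros]:
  "computable_in \<O> f \<Longrightarrow> computable_in \<O> g \<Longrightarrow> computable_in \<O> (\<lambda>x. prod_encode (f x, g x))"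
  unfolding computable_in_def by (drule partrec_in.pair, assumption) simp

lemma computable_in_pr1 [rec_intros]:
  "computable_in \<O> f \<Longrightarrow> computable_in \<O> (\<lambda>x. pr1 (f x))"
  by (rule computable_in_comp[of _ "\<lambda>x. pr1 x"]) (auto simp: computable_in_def intro: partrec_in.left)

lemma computable_in_pr2 [rec_intros]:
  "computable_in \<O> f \<Longrightarrow> computable_in \<O> (\<lambda>x. pr2 (f x))"
  by (rule computable_in_comp[of _ "\<lambda>x. pr2 x"]) (auto simp: computable_in_def intro: partrec_in.right)

lemma computable_in_Suc [rec_intros]:
  "computable_in \<O> f \<Longrightarrow> computable_in \<O> (\<lambda>x. Suc (f x))"
  by (rule computable_in_comp[of _ Suc]) (auto simp: computable_in_def intro: partrec_in.succ)

text \<open>The identity is not an initial function, but pairing the two projections of a number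
  gives the number back.\<close>

lemma computable_in_id [rec_intros]: "computable_in \<O> (\<lambda>x. x)"
proof -
  have "computable_in \<O> (\<lambda>x. prod_encode (pr1 x, pr2 x))"
    by (intro computable_in_prod_encode)
      (auto simp: computable_in_def intro: partrec_in.left partrec_in.right)
  then show ?thesis by simp
qed

lemma computable_in_const [rec_intros]: "computable_in \<O> (\<lambda>x. c)"
proof (induction c)
  case 0
  show ?case by (simp add: computable_in_def partrec_in.zero)
qed (rule computable_in_Suc)

text \<open>The step function may depend on the parameter \<open>x\<close>; the third assumption
  packs its arguments in the order used by \<open>prim_rec\<close>. The arithmetic below is obtained
  from this rule.\<close>

lemma computable_in_rec_nat [rec_intros]:
  assumes "computable_in \<O> f" and "computable_in \<O> h"
    and "computable_in \<O> (\<lambda>z. g (pr1 z) (pr1 (pr2 z)) (pr2 (pr2 z)))"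
  shows "computable_in \<O> (\<lambda>x. rec_nat (f x) (g x) (h x))"
proof -
  let ?r = "prim_rec (\<lambda>x. Some (f x)) (\<lambda>z. Some (g (pr1 z) (pr1 (pr2 z)) (pr2 (pr2 z))))"
  have "?r (prod_encode (x, m)) = Some (rec_nat (f x) (g x) m)" for x m
    by (induction m) (simp_all add: prim_rec_def)
  moreover have "partrec_in \<O> ?r"
    using assms(1,3) unfolding computable_in_def by (rule partrec_in.prec)
  then have "partrec_in \<O> (\<lambda>x. ?r (prod_encode (x, h x)))"
    by (rule partrec_in_comp) (intro computable_in_prod_encode computable_in_id assms(2))
  ultimately show ?thesis by (simp add: computable_in_def)
qed

lemma computable_in_add [rec_intros]:
  assumes "computable_in \<O> f" and "computable_in \<O> g"
  shows "computable_in \<O> (\<lambda>x. f x + g x)"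
proof -
  have "rec_nat a (\<lambda>_ r. Suc r) b = a + b" for a b :: nat by (induction b) auto
  moreover have "computable_in \<O> (\<lambda>x. rec_nat (f x) (\<lambda>_ r. Suc r) (g x))"
    by (intro rec_intros assms)
  ultimately show ?thesis by simp
qed

lemma computable_in_mult [rec_intros]:
  assumes "computable_in \<O> f" and "computable_in \<O> g"
  shows "computable_in \<O> (\<lambda>x. f x * g x)"
proof -
  have "rec_nat 0 (\<lambda>_ r. r + a) b = a * b" for a b :: nat by (induction b) auto
  moreover have "computable_in \<O> (\<lambda>x. rec_nat 0 (\<lambda>_ r. r + f x) (g x))"
    by (intro rec_intros assms computable_in_comp[OF assms(1)])
  ultimately show ?thesis by simp
qed

lemma computable_in_diff [rec_intros]:
  assumes "computable_in \<O> f" and "computable_in \<O> g"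
  shows "computable_in \<O> (\<lambda>x. f x - g x)"
proof -
  \<comment> \<open>A recursion returning the index of its last step computes the predecessor;
    iterating it gives truncated subtraction.\<close>
  have pred: "rec_nat 0 (\<lambda>y _. y) a = a - 1" for a :: nat by (cases a) auto
  have "rec_nat a (\<lambda>_ r. rec_nat 0 (\<lambda>y _. y) r) b = a - b" for a b :: nat
    by (induction b) (auto simp: pred)
  moreover have "computable_in \<O> (\<lambda>x. rec_nat (f x) (\<lambda>_ r. rec_nat 0 (\<lambda>y _. y) r) (g x))"
    by (intro rec_intros assms)
  ultimately show ?thesis by simp
qed

lemma computable_in_power [rec_intros]:
  assumes "computable_in \<O> f" and "computable_in \<O> g"
  shows "computable_in \<O> (\<lambda>x. f x ^ g x)"
proof -
  have "rec_nat 1 (\<lambda>_ r. r * a) b = a ^ b" for a b :: nat by (induction b) auto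
  moreover have "computable_in \<O> (\<lambda>x. rec_nat 1 (\<lambda>_ r. r * f x) (g x))"
    by (intro rec_intros assms computable_in_comp[OF assms(1)])
  ultimately show ?thesis by simp
qed

lemma computable_in_if [rec_intros]:
  assumes "decidable_in \<O> P" and "computable_in \<O> f" and "computable_in \<O> g"
  shows "computable_in \<O> (\<lambda>x. if P x then f x else g x)"
proof -
  \<comment> \<open>Both branches are total, so a recursion of length 0 or 1 can select between
    them.\<close>
  have "computable_in \<O> (\<lambda>x. rec_nat (g x) (\<lambda>_ _. f x) (if P x then 1 else 0))"
    using assms(1) unfolding decidable_in_def
    by (intro rec_intros assms computable_in_comp[OF assms(2)])
  moreover have "rec_nat (g x) (\<lambda>_ _. f x) (if P x then 1 else 0) = (if P x then f x else g x)" for x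
    by simp
  ultimately show ?thesis by simp
qed

lemma decidable_in_not [rec_intros]:
  assumes "decidable_in \<O> P"
  shows "decidable_in \<O> (\<lambda>x. \<not> P x)"
proof -
  have "computable_in \<O> (\<lambda>x. if P x then 0 else 1)"
    by (intro rec_intros assms)
  moreover have "(if P x then 0 else 1) = (if \<not> P x then 1 else (0::nat))" for x by simp
  ultimately show ?thesis unfolding decidable_in_def by simp
qed

lemma decidable_in_conj [rec_intros]:
  assumes "decidable_in \<O> P" and "decidable_in \<O> Q"
  shows "decidable_in \<O> (\<lambda>x. P x \<and> Q x)"
proof -
  have "computable_in \<O> (\<lambda>x. if P x then if Q x then 1 else 0 else 0)"
    by (intro rec_intros assms)
  moreover have "(if P x then if Q x then 1 else 0 else 0) = (if P x \<and> Q x then 1 else (0::nat))" for x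
    by simp
  ultimately show ?thesis unfolding decidable_in_def by simp
qed

lemma decidable_in_disj [rec_intros]:
  assumes "decidable_in \<O> P" and "decidable_in \<O> Q"
  shows "decidable_in \<O> (\<lambda>x. P x \<or> Q x)"
proof -
  have "decidable_in \<O> (\<lambda>x. \<not> (\<not> P x \<and> \<not> Q x))" by (intro rec_intros assms)
  then show ?thesis by simp
qed

lemma decidable_in_eq_0:
  assumes "computable_in \<O> f"
  shows "decidable_in \<O> (\<lambda>x. f x = 0)"
proof -
  have "computable_in \<O> (\<lambda>x. 1 - f x)"
    by (intro rec_intros assms)
  moreover have "1 - f x = (if f x = 0 then 1 else 0)" for x by simp
  ultimately show ?thesis unfolding decidable_in_def by simp
qed

lemma decidable_in_le [rec_intros]:
  assumes "computable_in \<O> f" and "computable_in \<O> g"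
  shows "decidable_in \<O> (\<lambda>x. f x \<le> g x)"
proof -
  have "decidable_in \<O> (\<lambda>x. f x - g x = 0)"
    by (intro rec_intros decidable_in_eq_0 assms)
  then show ?thesis by simp
qed

lemma decidable_in_less [rec_intros]:
  assumes "computable_in \<O> f" and "computable_in \<O> g"
  shows "decidable_in \<O> (\<lambda>x. f x < g x)"
proof -
  have "decidable_in \<O> (\<lambda>x. \<not> g x \<le> f x)"
    by (intro rec_intros assms)
  then show ?thesis by (simp add: not_le)
qed

lemma decidable_in_eq [rec_intros]:
  assumes "computable_in \<O> f" and "computable_in \<O> g"
  shows "decidable_in \<O> (\<lambda>x. f x = g x)"
proof -
  have "decidable_in \<O> (\<lambda>x. f x \<le> g x \<and> g x \<le> f x)"
    by (intro rec_intros assms)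
  then show ?thesis by (simp add: order_eq_iff)
qed

section \<open>Partial functions: binding and unbounded search\<close>

lemma partrec_in_Some:
  "computable_in \<O> f \<Longrightarrow> partrec_in \<O> (\<lambda>x. Some (f x))"
  by (simp add: computable_in_def)

text \<open>Plain composition forgets \<open>x\<close>, so \<open>x\<close> is paired with the value
  of \<open>f\<close> before \<open>g\<close> is applied.\<close>

lemma partrec_in_bind:
  assumes "partrec_in \<O> f" and "partrec_in \<O> (\<lambda>z. g (pr1 z) (pr2 z))"
  shows "partrec_in \<O> (\<lambda>x. Option.bind (f x) (\<lambda>v. g x v))"
proof -
  have "partrec_in \<O> (\<lambda>x. Option.bind (Option.bind (Some x) (\<lambda>a. Option.bind (f x)
      (\<lambda>b. Some (prod_encode (a, b))))) (\<lambda>z. g (pr1 z) (pr2 z)))"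
    using computable_in_id[of \<O>] unfolding computable_in_def
    by (intro partrec_in.comp[OF assms(2)] partrec_in.pair assms(1))
  moreover have "Option.bind (Option.bind (Some x) (\<lambda>a. Option.bind (f x)
      (\<lambda>b. Some (prod_encode (a, b))))) (\<lambda>z. g (pr1 z) (pr2 z)) = Option.bind (f x) (\<lambda>v. g x v)" for x
    by (cases "f x") simp_all
  ultimately show ?thesis by simp
qed

text \<open>For a decidable predicate the searched function is total, which makes the definedness
  condition in \<open>minimize\<close> vacuous.\<close>

lemma partrec_in_search:
  assumes "decidable_in \<O> (\<lambda>z. P (pr1 z) (pr2 z))"
  shows "partrec_in \<O> (\<lambda>x. if \<exists>n. P x n then Some (LEAST n. P x n) else None)"
proof -
  have "computable_in \<O> (\<lambda>z. if P (pr1 z) (pr2 z) then 0 else 1)" (is "computable_in \<O> ?c")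
    by (intro rec_intros assms)
  then have "partrec_in \<O> (minimize (\<lambda>z. Some (?c z)))"
    unfolding computable_in_def by (rule partrec_in.search)
  moreover have "Some (?c (prod_encode (x, n))) = Some 0 \<longleftrightarrow> P x n" for x n by simp
  then have "minimize (\<lambda>z. Some (?c z)) = (\<lambda>x. if \<exists>n. P x n then Some (LEAST n. P x n) else None)"
    unfolding minimize_def[abs_def] by (simp only: option.distinct not_False_eq_True simp_thms)
  ultimately show ?thesis by simp
qed

lemma computable_in_Least:
  assumes "decidable_in \<O> (\<lambda>z. P (pr1 z) (pr2 z))" and "\<And>x. \<exists>n. P x n"
  shows "computable_in \<O> (\<lambda>x. LEAST n. P x n)"
  using partrec_in_search[OF assms(1)] assms(2) by (simp add: computable_in_def)

section \<open>Stage approximations\<close>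

text \<open>\<open>F\<close> reports 0 for ``not yet converged'' and \<open>Suc v\<close> for convergence to \<open>v\<close>. The number \<open>a t\<close> codes the
  information available at stage \<open>t\<close>: with an oracle this is its initial segment of length \<open>t\<close>.\<close>

definition approximates :: "(nat \<Rightarrow> nat) \<Rightarrow> (nat \<Rightarrow> nat) \<Rightarrow> (nat \<Rightarrow> nat option) \<Rightarrow> bool" where
  "approximates a F f \<longleftrightarrow>
     (\<forall>x v t t'. F (prod_encode (x, a t)) = Suc v \<longrightarrow> t \<le> t' \<longrightarrow> F (prod_encode (x, a t')) = Suc v) \<and>
     (\<forall>x v. f x = Some v \<longleftrightarrow> (\<exists>t. F (prod_encode (x, a t)) = Suc v))"

lemma approximatesI:
  assumes "\<And>x v t t'. F (prod_encode (x, a t)) = Suc v \<Longrightarrow> t \<le> t' \<Longrightarrow> F (prod_encode (x, a t')) = Suc v"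
    and "\<And>x v t. F (prod_encode (x, a t)) = Suc v \<Longrightarrow> f x = Some v"
    and "\<And>x v. f x = Some v \<Longrightarrow> \<exists>t. F (prod_encode (x, a t)) = Suc v"
  shows "approximates a F f"
  using assms unfolding approximates_def by blast

lemma approximates_mono:
  "approximates a F f \<Longrightarrow> F (prod_encode (x, a t)) = Suc v \<Longrightarrow> t \<le> t' \<Longrightarrow> F (prod_encode (x, a t')) = Suc v"
  unfolding approximates_def by blast

lemma approximates_sound:
  "approximates a F f \<Longrightarrow> F (prod_encode (x, a t)) = Suc v \<Longrightarrow> f x = Some v"
  unfolding approximates_def by blast

lemma approximates_complete:
  "approximates a F f \<Longrightarrow> f x = Some v \<Longrightarrow> \<exists>t. F (prod_encode (x, a t)) = Suc v"
  unfolding approximates_def by blast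

text \<open>This form lets finitely many computations be brought to a common stage by taking
  maxima.\<close>

lemma approximates_eventually:
  "approximates a F f \<Longrightarrow> f x = Some v \<Longrightarrow> \<exists>t0. \<forall>t\<ge>t0. F (prod_encode (x, a t)) = Suc v"
  using approximates_complete approximates_mono by meson

lemma approximates_Some:
  "(\<And>x t. F (prod_encode (x, a t)) = Suc (f x)) \<Longrightarrow> approximates a F (\<lambda>x. Some (f x))"
  by (rule approximatesI) auto

lemma approximates_pair:
  assumes f: "approximates a F f" and g: "approximates a G g"
  shows "approximates a (\<lambda>z. if F z = 0 then 0 else if G z = 0 then 0 else Suc (prod_encode (F z - 1, G z - 1)))
    (\<lambda>n. Option.bind (f n) (\<lambda>a. Option.bind (g n) (\<lambda>b. Some (prod_encode (a, b)))))"
    (is "approximates a ?H ?h")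
proof (rule approximatesI)
  have H: "?H z = Suc v \<longleftrightarrow> (\<exists>b c. F z = Suc b \<and> G z = Suc c \<and> v = prod_encode (b, c))" for z v
    by (cases "F z"; cases "G z") auto
  show "?H (prod_encode (x, a t')) = Suc v" if "?H (prod_encode (x, a t)) = Suc v" "t \<le> t'" for x v t t'
    using that(1) approximates_mono[OF f _ that(2)] approximates_mono[OF g _ that(2)]
    unfolding H by blast
  show "?h x = Some v" if "?H (prod_encode (x, a t)) = Suc v" for x v t
    using that approximates_sound[OF f] approximates_sound[OF g] unfolding H by force
  show "\<exists>t. ?H (prod_encode (x, a t)) = Suc v" if "?h x = Some v" for x v
  proof -
    from that obtain b c where bc: "f x = Some b" "g x = Some c" "v = prod_encode (b, c)"
      by (auto simp: Option.bind_eq_Some_conv)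
    obtain t1 where "\<forall>t\<ge>t1. F (prod_encode (x, a t)) = Suc b"
      using approximates_eventually[OF f] bc by blast
    moreover obtain t2 where "\<forall>t\<ge>t2. G (prod_encode (x, a t)) = Suc c"
      using approximates_eventually[OF g] bc by blast
    ultimately have "?H (prod_encode (x, a (max t1 t2))) = Suc v"
      unfolding H using bc by auto
    then show ?thesis ..
  qed
qed

lemma approximates_comp:
  assumes f: "approximates a F f" and g: "approximates a G g"
  shows "approximates a (\<lambda>z. if G z = 0 then 0 else F (prod_encode (G z - 1, pr2 z)))
    (\<lambda>n. Option.bind (g n) f)" (is "approximates a ?H ?h")
proof (rule approximatesI)
  have H: "?H z = Suc v \<longleftrightarrow> (\<exists>c. G z = Suc c \<and> F (prod_encode (c, pr2 z)) = Suc v)" for z v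
    by (cases "G z") auto
  show "?H (prod_encode (x, a t')) = Suc v" if "?H (prod_encode (x, a t)) = Suc v" "t \<le> t'" for x v t t'
    using that(1) approximates_mono[OF f _ that(2)] approximates_mono[OF g _ that(2)]
    unfolding H by fastforce
  show "?h x = Some v" if "?H (prod_encode (x, a t)) = Suc v" for x v t
    using that approximates_sound[OF f] approximates_sound[OF g] unfolding H by force
  show "\<exists>t. ?H (prod_encode (x, a t)) = Suc v" if "?h x = Some v" for x v
  proof -
    from that obtain c where c: "g x = Some c" "f c = Some v"
      by (auto simp: Option.bind_eq_Some_conv)
    obtain t1 where "\<forall>t\<ge>t1. F (prod_encode (c, a t)) = Suc v"
      using approximates_eventually[OF f] c by blast
    moreover obtain t2 where "\<forall>t\<ge>t2. G (prod_encode (x, a t)) = Suc c"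
      using approximates_eventually[OF g] c by blast
    ultimately have "?H (prod_encode (x, a (max t1 t2))) = Suc v"
      unfolding H using c by auto
    then show ?thesis ..
  qed
qed

text \<open>By induction on the recursion depth: a recursion consults only finitely many
  computations, so they share a stage, and a report of 0 is passed on to all later steps.\<close>

lemma approximates_prim_rec:
  assumes f: "approximates a F f" and g: "approximates a G g"
  shows "approximates a (\<lambda>z. rec_nat (F (prod_encode (pr1 (pr1 z), pr2 z)))
      (\<lambda>y r. if r = 0 then 0 else G (prod_encode (prod_encode (pr1 (pr1 z), prod_encode (y, r - 1)), pr2 z)))
      (pr2 (pr1 z))) (prim_rec f g)"
proof -
  define H where "H b s = rec_nat (F (prod_encode (b, s)))
      (\<lambda>y r. if r = 0 then 0 else G (prod_encode (prod_encode (b, prod_encode (y, r - 1)), s)))" for b s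
  define h where "h b = rec_nat (f b) (\<lambda>y r. Option.bind r (\<lambda>i. g (prod_encode (b, prod_encode (y, i)))))" for b
  have H_Suc: "H b s (Suc m) = Suc v \<longleftrightarrow>
      (\<exists>c. H b s m = Suc c \<and> G (prod_encode (prod_encode (b, prod_encode (m, c)), s)) = Suc v)" for b s m v
    by (cases "H b s m") (auto simp: H_def)
  have h_Suc: "h b (Suc m) = Some v \<longleftrightarrow>
      (\<exists>c. h b m = Some c \<and> g (prod_encode (b, prod_encode (m, c))) = Some v)" for b m v
    by (auto simp: h_def Option.bind_eq_Some_conv)
  have mono: "H b (a t') m = Suc v" if "H b (a t) m = Suc v" "t \<le> t'" for b t t' m v
    using that(1)
  proof (induction m arbitrary: v)
    case 0
    then show ?case using approximates_mono[OF f _ that(2)] by (simp add: H_def)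
  next
    case (Suc m)
    then show ?case using approximates_mono[OF g _ that(2)] unfolding H_Suc by blast
  qed
  have sound: "h b m = Some v" if "H b (a t) m = Suc v" for b t m v
    using that
  proof (induction m arbitrary: v)
    case 0
    then show ?case using approximates_sound[OF f] by (simp add: H_def h_def)
  next
    case (Suc m)
    then show ?case using approximates_sound[OF g] unfolding H_Suc h_Suc by blast
  qed
  have complete: "\<exists>t. H b (a t) m = Suc v" if "h b m = Some v" for b m v
    using that
  proof (induction m arbitrary: v)
    case 0
    then show ?case using approximates_complete[OF f] by (simp add: H_def h_def)
  next
    case (Suc m)
    then obtain c where c: "h b m = Some c" "g (prod_encode (b, prod_encode (m, c))) = Some v"
      unfolding h_Suc by blast
    obtain t1 where "H b (a t1) m = Suc c" using Suc.IH[OF c(1)] ..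
    then have "H b (a (max t1 t2)) m = Suc c" for t2 by (rule mono) simp
    moreover obtain t2 where "\<forall>t\<ge>t2. G (prod_encode (prod_encode (b, prod_encode (m, c)), a t)) = Suc v"
      using approximates_eventually[OF g c(2)] by blast
    ultimately have "H b (a (max t1 t2)) (Suc m) = Suc v" unfolding H_Suc by auto
    then show ?case ..
  qed
  have "prim_rec f g = (\<lambda>x. h (pr1 x) (pr2 x))"
    by (rule ext) (simp add: prim_rec_def h_def split: prod.split)
  moreover have "approximates a (\<lambda>z. H (pr1 (pr1 z)) (pr2 z) (pr2 (pr1 z))) (\<lambda>x. h (pr1 x) (pr2 x))"
    by (rule approximatesI; simp only: prod_encode_inverse fst_conv snd_conv)
      (fact mono, fact sound, fact complete)
  ultimately have "approximates a (\<lambda>z. H (pr1 (pr1 z)) (pr2 z) (pr2 (pr1 z))) (prim_rec f g)"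
    by simp
  then show ?thesis unfolding H_def .
qed

text \<open>The definition asks for definedness only below some zero. The least zero is not above
  that one, so everything below it is defined, and positive by minimality.\<close>

lemma minimize_eq_Some:
  "minimize f b = Some n \<longleftrightarrow>
     f (prod_encode (b, n)) = Some 0 \<and> (\<forall>m<n. \<exists>k. f (prod_encode (b, m)) = Some (Suc k))"
  (is "?l \<longleftrightarrow> ?r")
proof
  let ?P = "\<lambda>n. f (prod_encode (b, n)) = Some 0"
  assume ?l
  then obtain k where k: "?P k" "\<forall>m<k. f (prod_encode (b, m)) \<noteq> None" and n: "n = (LEAST n. ?P n)"
    unfolding minimize_def by (auto split: if_splits)
  have "?P n" unfolding n using k(1) by (rule LeastI)
  moreover have "n \<le> k" unfolding n using k(1) by (rule Least_le)
  moreover have "\<not> ?P m" if "m < n" for m using that not_less_Least unfolding n by blast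
  ultimately show ?r using k(2) by (metis less_le_trans not_None_eq not0_implies_Suc)
next
  assume r: ?r
  then have "(LEAST n. f (prod_encode (b, n)) = Some 0) = n"
    by (intro Least_equality) (auto simp: not_less[symmetric])
  moreover have "\<exists>n. f (prod_encode (b, n)) = Some 0 \<and> (\<forall>m<n. f (prod_encode (b, m)) \<noteq> None)"
    using r by (intro exI[of _ n]) auto
  ultimately show ?l unfolding minimize_def by simp
qed

text \<open>The search is cut off at the stage number, which makes the approximation total.\<close>

lemma approximates_minimize:
  assumes f: "approximates a F f" and L: "\<And>t. L (a t) = t"
  defines "N \<equiv> \<lambda>z. LEAST n. F (prod_encode (prod_encode (pr1 z, n), pr2 z)) \<le> 1 \<or> L (pr2 z) \<le> n"
  shows "approximates a (\<lambda>z. if F (prod_encode (prod_encode (pr1 z, N z), pr2 z)) = 1 then Suc (N z) else 0)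
    (minimize f)"
    (is "approximates a ?H ?h")
proof -
  let ?Q = "\<lambda>b t n. F (prod_encode (prod_encode (b, n), a t))"
  \<comment> \<open>A report of 1 is convergence to 0, a report of at least 2 convergence to a
    positive value. A report of 0 also ends the search, but then no result is given.\<close>
  have N: "N (prod_encode (b, a t)) = n" if "?Q b t n = 1 \<and> (\<forall>m<n. ?Q b t m \<ge> 2) \<and> n \<le> t" for b t n
    unfolding N_def using that by (intro Least_equality) (auto simp: L not_less[symmetric])
  have H: "?H (prod_encode (b, a t)) = Suc n \<longleftrightarrow> ?Q b t n = 1 \<and> (\<forall>m<n. ?Q b t m \<ge> 2) \<and> n \<le> t" for b t n
  proof
    assume "?H (prod_encode (b, a t)) = Suc n"
    then have n: "N (prod_encode (b, a t)) = n" "?Q b t n = 1" by (auto split: if_splits)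
    have "n \<le> t" unfolding n(1)[symmetric] N_def by (rule Least_le) (simp add: L)
    moreover have "?Q b t m \<ge> 2" if "m < n" for m
      using that not_less_Least[of m "\<lambda>n. ?Q b t n \<le> 1 \<or> t \<le> n"] n(1)[unfolded N_def] by (simp add: L)
    ultimately show "?Q b t n = 1 \<and> (\<forall>m<n. ?Q b t m \<ge> 2) \<and> n \<le> t" using n by blast
  qed (use N in auto)
  have ge2: "k \<ge> 2 \<longleftrightarrow> (\<exists>j. k = Suc (Suc j))" for k by presburger
  show ?thesis
  proof (rule approximatesI)
    show "?H (prod_encode (b, a t')) = Suc n" if "?H (prod_encode (b, a t)) = Suc n" "t \<le> t'" for b n t t'
      using that(1) approximates_mono[OF f _ that(2)] le_trans[OF _ that(2)]
      unfolding H unfolding ge2 One_nat_def by blast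
    show "?h b = Some n" if "?H (prod_encode (b, a t)) = Suc n" for b n t
      using that approximates_sound[OF f] unfolding H unfolding ge2 One_nat_def minimize_eq_Some by blast
    show "\<exists>t. ?H (prod_encode (b, a t)) = Suc n" if "?h b = Some n" for b n
    proof -
      \<comment> \<open>Induction on \<open>k\<close> finds one stage that works for all the
        finitely many arguments below \<open>n\<close>.\<close>
      have "\<exists>t0. \<forall>m<k. \<forall>t\<ge>t0. ?Q b t m \<ge> 2" if "k \<le> n" for k
        using that
      proof (induction k)
        case (Suc k)
        then obtain t0 where t0: "\<forall>m<k. \<forall>t\<ge>t0. ?Q b t m \<ge> 2" by auto
        obtain j where "f (prod_encode (b, k)) = Some (Suc j)"
          using \<open>?h b = Some n\<close> Suc.prems unfolding minimize_eq_Some by (meson Suc_le_lessD)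
        then obtain t1 where "\<forall>t\<ge>t1. ?Q b t k = Suc (Suc j)"
          using approximates_eventually[OF f] by blast
        with t0 have "\<forall>m<Suc k. \<forall>t\<ge>max t0 t1. ?Q b t m \<ge> 2" by (auto simp: less_Suc_eq)
        then show ?case ..
      qed simp
      then obtain t0 where t0: "\<forall>m<n. \<forall>t\<ge>t0. ?Q b t m \<ge> 2" by blast
      obtain t1 where t1: "\<forall>t\<ge>t1. ?Q b t n = Suc 0"
        using approximates_eventually[OF f, of "prod_encode (b, n)" 0] \<open>?h b = Some n\<close>
        unfolding minimize_eq_Some by blast
      \<comment> \<open>The stage must also reach \<open>n\<close>, since the cut-off stops the
        search at the stage number.\<close>
      have "?H (prod_encode (b, a (max n (max t0 t1)))) = Suc n"
        unfolding H using t0 t1 by auto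
      then show ?thesis ..
    qed
  qed
qed

text \<open>The use principle, by induction on the derivation: a converging computation needs only
  finitely much oracle information. \<open>F\<close> itself is recursive without oracle:
  \<open>Q\<close> reads oracle answers off the stage code, and \<open>L\<close> recovers the stage
  for cut-offs.\<close>

lemma approximation_exists:
  assumes "partrec_in \<O> f" and L: "computable_in {} L" "\<And>t. L (a t) = t"
    and oracles: "\<And>q. q \<in> \<O> \<Longrightarrow>
      \<exists>Q. computable_in {} Q \<and> (\<forall>t x. x < t \<longrightarrow> Q (prod_encode (a t, x)) = q x)"
  shows "\<exists>F. computable_in {} F \<and> approximates a F f"
  using assms(1)
proof induction
  case zero
  show ?case
    by (rule exI[of _ "\<lambda>_. Suc 0"]) (intro conjI rec_intros approximates_Some, simp)
next
  case succ
  show ?case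
    by (rule exI[of _ "\<lambda>z. Suc (Suc (pr1 z))"]) (intro conjI rec_intros approximates_Some, simp)
next
  case left
  show ?case
    by (rule exI[of _ "\<lambda>z. Suc (pr1 (pr1 z))"]) (intro conjI rec_intros approximates_Some, simp)
next
  case right
  show ?case
    by (rule exI[of _ "\<lambda>z. Suc (pr2 (pr1 z))"]) (intro conjI rec_intros approximates_Some, simp)
next
  case (orac q)
  then obtain Q where Q: "computable_in {} Q" "\<And>t x. x < t \<Longrightarrow> Q (prod_encode (a t, x)) = q x"
    using oracles by blast
  let ?F = "\<lambda>z. if pr1 z < L (pr2 z) then Suc (Q (prod_encode (pr2 z, pr1 z))) else 0"
  have "computable_in {} ?F"
    by (intro rec_intros computable_in_comp[OF L(1)] computable_in_comp[OF Q(1)])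
  moreover have "approximates a ?F (\<lambda>n. Some (q n))"
    by (rule approximatesI) (auto simp: L(2) Q(2) split: if_splits)
  ultimately show ?case by blast
next
  case (pair f g)
  then obtain F G where F: "computable_in {} F" "approximates a F f"
    and G: "computable_in {} G" "approximates a G g" by blast
  show ?case
    by (rule exI, rule conjI[OF _ approximates_pair[OF F(2) G(2)]])
      (intro rec_intros F(1) G(1))
next
  case (comp f g)
  then obtain F G where F: "computable_in {} F" "approximates a F f"
    and G: "computable_in {} G" "approximates a G g" by blast
  show ?case
    by (rule exI, rule conjI[OF _ approximates_comp[OF F(2) G(2)]])
      (intro rec_intros computable_in_comp[OF F(1)] G(1))
next
  case (prec f g)
  then obtain F G where F: "computable_in {} F" "approximates a F f"
    and G: "computable_in {} G" "approximates a G g" by blast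
  show ?case
    by (rule exI, rule conjI[OF _ approximates_prim_rec[OF F(2) G(2)]])
      (intro rec_intros computable_in_comp[OF F(1)] computable_in_comp[OF G(1)])
next
  case (search f)
  then obtain F where F: "computable_in {} F" "approximates a F f" by blast
  have N: "computable_in {} (\<lambda>z. LEAST n. F (prod_encode (prod_encode (pr1 z, n), pr2 z)) \<le> 1 \<or> L (pr2 z) \<le> n)"
    by (rule computable_in_Least)
      (intro rec_intros computable_in_comp[OF F(1)] computable_in_comp[OF L(1)], blast)
  show ?case
    by (rule exI, rule conjI[OF _ approximates_minimize[OF F(2) L(2)]])
      (intro rec_intros computable_in_comp[OF F(1)] N)
qed

corollary recursive_approximation:
  assumes "partrec_in {} f"
  shows "\<exists>F. computable_in {} F \<and> approximates (\<lambda>t. t) F f"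
  by (rule approximation_exists[OF assms]) (auto intro: computable_in_id)

section \<open>Strings and initial segments\<close>

lemma str_of_num_num_of_str [simp]: "str_of_num (num_of_str w) = w"
  unfolding str_of_num_def using bij_num_of_str by (simp add: bij_is_inj)

lemma num_of_str_str_of_num [simp]: "num_of_str (str_of_num n) = n"
  unfolding str_of_num_def using bij_num_of_str by (simp add: bij_is_surj surj_f_inv_f)

lemma length_le_num_of_str: "length w \<le> num_of_str w"
  by (induction w rule: rev_induct) (auto simp: num_of_str_snoc)

lemma length_str_of_num_le: "length (str_of_num n) \<le> n"
  using length_le_num_of_str[of "str_of_num n"] by simp

text \<open>The bound is attained by strings consisting of \<open>True\<close> only; this exact form
  carries the induction.\<close>

lemma num_of_str_bound: "num_of_str w + 2 \<le> 2 ^ Suc (length w)"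
  by (induction w rule: rev_induct) (auto simp: num_of_str_snoc num_of_str_def[of "[]"])

lemma num_of_str_less: "length w < n \<Longrightarrow> num_of_str w < 2 ^ n"
proof -
  assume "length w < n"
  then have "(2::nat) ^ Suc (length w) \<le> 2 ^ n" by (intro power_increasing) auto
  then show ?thesis using num_of_str_bound[of w] by linarith
qed

section \<open>Coding initial segments of an oracle\<close>

abbreviation char_fun :: "nat set \<Rightarrow> nat \<Rightarrow> nat" where
  "char_fun A \<equiv> \<lambda>n. if n \<in> A then 1 else 0"

definition segment_code :: "nat set \<Rightarrow> nat \<Rightarrow> nat" where
  "segment_code A t = num_of_str (A \<restriction> t)"

lemma segment_code_0 [simp]: "segment_code A 0 = 0"
  by (simp add: segment_code_def initial_segment_def num_of_str_def)

lemma segment_code_Suc [simp]: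
  "segment_code A (Suc t) = 2 * segment_code A t + (if t \<in> A then 2 else 1)"
  by (simp add: segment_code_def initial_segment_def num_of_str_snoc)

lemma str_of_num_segment_code [simp]: "str_of_num (segment_code A t) = A \<restriction> t"
  by (simp add: segment_code_def)

lemma segment_code_ge: "t \<le> segment_code A t"
  by (induction t) auto

lemma decidable_in_oracle:
  "computable_in {char_fun A} f \<Longrightarrow> decidable_in {char_fun A} (\<lambda>x. f x \<in> A)"
  unfolding decidable_in_def
  by (rule computable_in_comp[of _ "char_fun A"]) (auto intro: computable_in_oracle)

lemma computable_in_segment_code: "computable_in {char_fun A} (segment_code A)"
proof -
  have "computable_in {char_fun A} (\<lambda>t. rec_nat 0 (\<lambda>y r. 2 * r + (if y \<in> A then 2 else 1)) t)"
    by (intro rec_intros decidable_in_oracle)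
  moreover have "rec_nat 0 (\<lambda>y r. 2 * r + (if y \<in> A then 2 else 1)) t = segment_code A t" for t
    by (induction t) auto
  ultimately show ?thesis by simp
qed

text \<open>The least \<open>k\<close> with \<open>r \<le> 2 * k + 2\<close> is \<open>(r - 1) div 2\<close>: the string coded by \<open>r\<close> without its last bit.\<close>

definition drop_bits :: "nat \<Rightarrow> nat \<Rightarrow> nat" where
  "drop_bits s i = rec_nat s (\<lambda>_ r. LEAST k. r \<le> 2 * k + 2) i"

lemma computable_in_drop_bits [rec_intros]:
  assumes "computable_in \<O> f" and "computable_in \<O> g"
  shows "computable_in \<O> (\<lambda>x. drop_bits (f x) (g x))"
proof -
  have parent: "computable_in \<O> (\<lambda>r. LEAST k. r \<le> 2 * k + 2)"
    by (rule computable_in_Least) (intro rec_intros, presburger)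
  then show ?thesis unfolding drop_bits_def
    by (intro rec_intros assms computable_in_comp[OF parent])
qed

lemma drop_bits_segment_code: "drop_bits (segment_code A t) i = segment_code A (t - i)"
proof (induction i)
  case (Suc i)
  \<comment> \<open>The code 0 of the empty string is its own parent, which matches truncated
    subtraction.\<close>
  have "(LEAST k. segment_code A m \<le> 2 * k + 2) = segment_code A (m - 1)" for m
    by (rule Least_equality) (cases m; auto split: if_splits)+
  with Suc show ?case by (simp add: drop_bits_def)
qed (simp add: drop_bits_def)

text \<open>Segment codes can serve as stage codes because the length and the individual bits are
  recursively recoverable from them.\<close>

lemma oracle_approximation:
  assumes "partrec_in {char_fun A} f"
  shows "\<exists>F. computable_in {} F \<and> approximates (segment_code A) F f"
proof -
  \<comment> \<open>The length is the number of bits to drop until the empty string is reached. The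
    disjunct \<open>s \<le> i\<close> makes the search total for every \<open>s\<close>; by
    \<open>segment_code_ge\<close> it never ends the search on a segment code too early.\<close>
  define L where "L s = (LEAST i. drop_bits s i = 0 \<or> s \<le> i)" for s
  have L: "computable_in {} L"
    unfolding L_def[abs_def] by (rule computable_in_Least) (intro rec_intros, blast)
  have L_eq: "L (segment_code A t) = t" for t
    unfolding L_def drop_bits_segment_code
  proof (rule Least_equality)
    show "t \<le> i" if "segment_code A (t - i) = 0 \<or> segment_code A t \<le> i" for i
      using that segment_code_ge[of "t - i" A] segment_code_ge[of t A] by linarith
  qed simp
  \<comment> \<open>Keeping the first \<open>Suc x\<close> bits leaves bit \<open>x\<close> last; it
    is \<open>True\<close> exactly when the code is twice its parent plus 2.\<close>
  define Q where "Q z = (let m = drop_bits (pr1 z) (L (pr1 z) - Suc (pr2 z))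
    in if m = 2 * drop_bits m 1 + 2 then 1 else (0::nat))" for z
  have Q: "computable_in {} Q"
    unfolding Q_def[abs_def] Let_def by (intro rec_intros computable_in_comp[OF L])
  have Q_eq: "Q (prod_encode (segment_code A t, x)) = char_fun A x" if "x < t" for t x
  proof -
    have "t - (t - Suc x) = Suc x" using that by simp
    then show ?thesis
      unfolding Q_def by (simp add: Let_def L_eq drop_bits_segment_code del: segment_code_Suc) simp
  qed
  show ?thesis
    by (rule approximation_exists[OF assms L L_eq]) (use Q Q_eq in blast)
qed

section \<open>Avoiding partial recursive functions\<close>

lemma universal_function:
  "acceptable_numbering \<phi> \<Longrightarrow> partrec_in {} (\<lambda>z. \<phi> (pr1 z) (pr2 z))"
  by (simp add: acceptable_numbering_def partial_recursive2_def partial_recursive_def split_beta)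

lemma s_m_n:
  assumes "acceptable_numbering \<phi>" and "partrec_in {} \<psi>"
  shows "\<exists>s. computable_in {} s \<and> (\<forall>e x. \<phi> (s e) x = \<psi> (prod_encode (e, x)))"
proof -
  have "partial_recursive2 (\<lambda>e x. \<psi> (prod_encode (e, x)))"
    using assms(2) by (simp add: partial_recursive2_def partial_recursive_def split_beta)
  then obtain s where "recursive s" "\<forall>e. \<phi> (s e) = (\<lambda>x. \<psi> (prod_encode (e, x)))"
    using assms(1) unfolding acceptable_numbering_def by blast
  then show ?thesis
    by (auto simp: recursive_def partial_recursive_def computable_in_def)
qed

text \<open>With a dummy parameter in the s-m-n property, every value of \<open>s\<close> is an
  index.\<close>

lemma index_exists:
  assumes "acceptable_numbering \<phi>" and "partrec_in {} f"
  shows "\<exists>e. \<forall>x. \<phi> e x = f x"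
proof -
  have "partrec_in {} (\<lambda>z. f (pr2 z))"
    by (intro partrec_in_comp[OF assms(2)] rec_intros)
  from s_m_n[OF assms(1) this] show ?thesis by auto
qed

lemma partrec_in_diagonal:
  "acceptable_numbering \<phi> \<Longrightarrow> partrec_in {} (\<lambda>x. \<phi> x x)"
  using partrec_in_comp[OF universal_function computable_in_prod_encode[OF computable_in_id computable_in_id]]
  by simp

lemma DNR_avoids:
  assumes acc: "acceptable_numbering \<phi>" and "DNR \<phi> f" and f: "computable_in \<O> f"
    and \<psi>: "partrec_in {} \<psi>" and b: "computable_in {} b"
  shows "\<exists>h. computable_in \<O> h \<and> (\<forall>n. \<forall>i<b n. \<psi> (prod_encode (n, i)) \<noteq> Some (h n))"
proof -
  \<comment> \<open>Tuples are right-nested pairs, with the entry pushed last in front. Hence the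
    item with index \<open>i\<close> of a tuple of length \<open>b n\<close> sits at position
    \<open>b n - Suc i\<close>.\<close>
  define entry where "entry c j = pr1 (rec_nat c (\<lambda>_ r. pr2 r) j)" for c j
  \<comment> \<open>The function with index \<open>s (prod_encode (n, i))\<close> is constant, so
    its diagonal value is an entry of the value to be avoided.\<close>
  have "partrec_in {} (\<lambda>z. Option.bind (\<psi> (pr1 z)) (\<lambda>v. Some (entry v (b (pr1 (pr1 z)) - Suc (pr2 (pr1 z))))))"
    unfolding entry_def
    by (intro partrec_in_bind partrec_in_Some partrec_in_comp[OF \<psi>] rec_intros computable_in_comp[OF b])
  from s_m_n[OF acc this] obtain s where s: "computable_in {} s"
    and \<phi>_s: "\<And>n i x. \<phi> (s (prod_encode (n, i))) x =
      Option.bind (\<psi> (prod_encode (n, i))) (\<lambda>v. Some (entry v (b n - Suc i)))"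
    by auto
  define tuple where "tuple n k = rec_nat 0 (\<lambda>k r. prod_encode (f (s (prod_encode (n, k))), r)) k" for n k
  have shift: "entry c (Suc j) = entry (pr2 c) j" for c j
  proof -
    have "rec_nat c (\<lambda>_ r. pr2 r) (Suc j) = rec_nat (pr2 c) (\<lambda>_ r. pr2 r) j"
      by (induction j) simp_all
    then show ?thesis unfolding entry_def by simp
  qed
  have entry_tuple: "entry (tuple n k) (k - Suc i) = f (s (prod_encode (n, i)))" if "i < k" for n k i
    using that
  proof (induction k)
    case (Suc k)
    show ?case
    proof (cases "i = k")
      case True
      then show ?thesis by (simp add: entry_def tuple_def)
    next
      case False
      with Suc.prems have i: "i < k" by simp
      then have "Suc k - Suc i = Suc (k - Suc i)" by simp
      with Suc.IH[OF i] show ?thesis by (simp add: shift) (simp add: tuple_def)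
    qed
  qed simp
  have "computable_in \<O> (\<lambda>n. tuple n (b n))"
    unfolding tuple_def
    by (intro rec_intros computable_in_comp[OF f] computable_in_comp[OF computable_in_mono[OF s]]
        computable_in_mono[OF b])
  moreover have "\<psi> (prod_encode (n, i)) \<noteq> Some (tuple n (b n))" if "i < b n" for n i
  proof
    \<comment> \<open>The diagonal value at the index for \<open>(n, i)\<close> would then be the
      value of \<open>f\<close> at that same index.\<close>
    assume "\<psi> (prod_encode (n, i)) = Some (tuple n (b n))"
    then have "\<phi> (s (prod_encode (n, i))) (s (prod_encode (n, i))) = Some (f (s (prod_encode (n, i))))"
      unfolding \<phi>_s by (simp add: entry_tuple[OF that])
    with \<open>DNR \<phi> f\<close> show False unfolding DNR_def by blast
  qed
  ultimately show ?thesis by blast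
qed

lemma prod_encode_mono:
  assumes "a \<le> c" and "b \<le> d"
  shows "prod_encode (a, b) \<le> prod_encode (c, d)"
proof -
  have "triangle (a + b) \<le> triangle (c + d)"
    unfolding triangle_def using assms by (intro div_le_mono mult_le_mono) auto
  with assms show ?thesis by (simp add: prod_encode_def)
qed

text \<open>Letting the universal function play the role of \<psi>, with \<open>(e, i)\<close>
  packed into one argument, makes \<open>h\<close> depend on \<open>b\<close> only. By monotonicity
  of pairing, the bound covers all \<open>e \<le> n\<close> and \<open>i < b n\<close>, so the index
  of \<psi> serves as \<open>N\<close>.\<close>

lemma DNR_avoids_almost_everywhere:
  assumes acc: "acceptable_numbering \<phi>" and "DNR \<phi> f" and "computable_in \<O> f"
    and b: "computable_in {} b"
  shows "\<exists>h. computable_in \<O> h \<and>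
    (\<forall>\<psi>. partrec_in {} \<psi> \<longrightarrow> (\<exists>N. \<forall>n\<ge>N. \<forall>i<b n. \<psi> (prod_encode (n, i)) \<noteq> Some (h n)))"
proof -
  have \<psi>: "partrec_in {} (\<lambda>z. \<phi> (pr1 (pr2 z)) (prod_encode (pr1 z, pr2 (pr2 z))))"
    using partrec_in_comp[OF universal_function[OF acc],
        of "\<lambda>z. prod_encode (pr1 (pr2 z), prod_encode (pr1 z, pr2 (pr2 z)))"]
    by (simp add: rec_intros)
  have "computable_in {} (\<lambda>n. Suc (prod_encode (n, b n)))"
    by (intro rec_intros b)
  from DNR_avoids[OF assms(1-3) \<psi> this]
  obtain h where h: "computable_in \<O> h" and avoid: "\<And>n e i. prod_encode (e, i) \<le> prod_encode (n, b n) \<Longrightarrow>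
      \<phi> e (prod_encode (n, i)) \<noteq> Some (h n)"
    by (metis fst_conv less_Suc_eq_le prod_encode_inverse snd_conv)
  have "\<exists>N. \<forall>n\<ge>N. \<forall>i<b n. \<psi> (prod_encode (n, i)) \<noteq> Some (h n)" if *: "partrec_in {} \<psi>" for \<psi>
  proof -
    obtain e where "\<And>x. \<phi> e x = \<psi> x" using index_exists[OF acc *] by blast
    then have "\<forall>n\<ge>e. \<forall>i<b n. \<psi> (prod_encode (n, i)) \<noteq> Some (h n)"
      using avoid[of e] by (simp add: prod_encode_mono)
    then show ?thesis ..
  qed
  with h show ?thesis by blast
qed

text \<open>Finitely many arguments are patched by a constant above all diagonal values
  there.\<close>

lemma almost_DNR_imp_DNR:
  assumes "computable_in \<O> f" and "\<And>n v. n \<ge> N \<Longrightarrow> \<phi> n n = Some v \<Longrightarrow> f n \<noteq> v"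
  shows "\<exists>f'. computable_in \<O> f' \<and> DNR \<phi> f'"
proof -
  \<comment> \<open>At undefined places \<open>the None\<close> is some fixed number, which can only
    enlarge the sum.\<close>
  define M where "M = Suc (\<Sum>n<N. the (\<phi> n n))"
  have "v < M" if "n < N" "\<phi> n n = Some v" for n v
    using member_le_sum[of n "{..<N}" "\<lambda>n. the (\<phi> n n)"] that by (simp add: M_def)
  then have "DNR \<phi> (\<lambda>n. if n < N then M else f n)"
    using assms(2) unfolding DNR_def by (auto simp: not_less)
  moreover have "computable_in \<O> (\<lambda>n. if n < N then M else f n)"
    by (intro rec_intros assms)
  ultimately show ?thesis by blast
qed

section \<open>Enumeration, complexity and autocomplexity\<close>

text \<open>Every element of \<open>W m\<close> is listed once, at the first stage \<open>t\<close> at which \<open>\<phi> m\<close> converges on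
  it; \<open>listed m s\<close> says that the pair \<open>s = (x, t)\<close> is such an event.\<close>

lemma W_enumeration:
  assumes acc: "acceptable_numbering \<phi>"
  shows "\<exists>E. partrec_in {} E \<and>
    (\<forall>m x. finite (W \<phi> m) \<longrightarrow> x \<in> W \<phi> m \<longrightarrow> (\<exists>i<card (W \<phi> m). E (prod_encode (m, i)) = Some x))"
proof -
  obtain F where F: "computable_in {} F"
    and approx: "approximates (\<lambda>t. t) F (\<lambda>z. \<phi> (pr1 z) (pr2 z))"
    using recursive_approximation[OF universal_function[OF acc]] by blast
  define conv where "conv m x t \<longleftrightarrow> F (prod_encode (prod_encode (m, x), t)) \<noteq> 0" for m x t
  define listed where "listed m s \<longleftrightarrow> conv m (pr1 s) (pr2 s) \<and> (pr2 s = 0 \<or> \<not> conv m (pr1 s) (pr2 s - 1))"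
    for m s
  define count where "count m s = rec_nat 0 (\<lambda>y r. if listed m y then Suc r else r) s" for m s
  \<comment> \<open>The element listed with number \<open>i\<close> comes from the event preceded by
    exactly \<open>i\<close> events.\<close>
  define E where "E z = Option.bind
    (if \<exists>s. listed (pr1 z) s \<and> count (pr1 z) s = pr2 z
     then Some (LEAST s. listed (pr1 z) s \<and> count (pr1 z) s = pr2 z) else None)
    (\<lambda>s. Some (pr1 s))" for z
  have conv_mono: "conv m x t'" if conv: "conv m x t" and "t \<le> t'" for m x t t'
  proof -
    obtain v where "F (prod_encode (prod_encode (m, x), t)) = Suc v"
      using conv unfolding conv_def by (meson not0_implies_Suc)
    then show ?thesis
      using approximates_mono[OF approx _ \<open>t \<le> t'\<close>] unfolding conv_def by simp
  qed
  have conv_W: "(\<exists>t. conv m x t) \<longleftrightarrow> x \<in> W \<phi> m" for m x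
  proof
    assume "\<exists>t. conv m x t"
    then obtain t v where "F (prod_encode (prod_encode (m, x), t)) = Suc v"
      unfolding conv_def by (meson not0_implies_Suc)
    from approximates_sound[OF approx this] show "x \<in> W \<phi> m" by (auto simp: W_def)
  next
    assume "x \<in> W \<phi> m"
    then obtain v where "\<phi> m x = Some v" by (auto simp: W_def)
    then obtain t where "F (prod_encode (prod_encode (m, x), t)) = Suc v"
      using approximates_complete[OF approx, of "prod_encode (m, x)" v] by auto
    then show "\<exists>t. conv m x t" unfolding conv_def by (metis nat.distinct(1))
  qed
  \<comment> \<open>Convergence persists, so the later of two events for one element would already
    have converged a stage earlier.\<close>
  have "pr2 s \<le> pr2 s'" if "listed m s" "listed m s'" "pr1 s = pr1 s'" for m s s'
    using that conv_mono[of m "pr1 s'" "pr2 s'" "pr2 s - 1"] unfolding listed_def by fastforce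
  then have inj: "inj_on (\<lambda>s. pr1 s) {s. listed m s}" for m
    by (intro inj_onI) (metis dual_order.antisym mem_Collect_eq prod.collapse prod_decode_inverse)
  have image: "(\<lambda>s. pr1 s) ` {s. listed m s} = W \<phi> m" for m
  proof (intro equalityI subsetI)
    fix x assume "x \<in> W \<phi> m"
    then have ex: "\<exists>t. conv m x t" using conv_W by blast
    define t where "t = (LEAST t. conv m x t)"
    have "conv m x t" unfolding t_def using ex by (rule LeastI_ex)
    moreover have "t = 0 \<or> \<not> conv m x (t - 1)"
      using not_less_Least[of "t - 1" "conv m x"] unfolding t_def[symmetric] by fastforce
    ultimately have "listed m (prod_encode (x, t))" unfolding listed_def by simp
    then show "x \<in> (\<lambda>s. pr1 s) ` {s. listed m s}" by (intro image_eqI[of _ _ "prod_encode (x, t)"]) auto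
  next
    fix x assume "x \<in> (\<lambda>s. pr1 s) ` {s. listed m s}"
    then show "x \<in> W \<phi> m" using conv_W unfolding listed_def by blast
  qed
  have count: "count m s = card {y. y < s \<and> listed m y}" for m s
  proof (induction s)
    case (Suc s)
    have "{y. y < Suc s \<and> listed m y} =
        (if listed m s then insert s {y. y < s \<and> listed m y} else {y. y < s \<and> listed m y})"
      by (auto simp: less_Suc_eq)
    with Suc show ?case by (simp add: count_def)
  qed (simp add: count_def)
  have count_less: "count m s < count m s'" if "listed m s" "s < s'" for m s s'
    unfolding count using that by (intro psubset_card_mono) auto
  have "\<exists>i<card (W \<phi> m). E (prod_encode (m, i)) = Some x" if fin: "finite (W \<phi> m)" and x: "x \<in> W \<phi> m" for m x
  proof -
    obtain s where s: "listed m s" "x = pr1 s" using x unfolding image[symmetric] by auto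
    have "finite {s. listed m s}"
      using fin inj[of m] unfolding image[symmetric] by (rule finite_imageD)
    then have "count m s < card {s. listed m s}"
      unfolding count using s(1) by (intro psubset_card_mono) auto
    also have "card {s. listed m s} = card (W \<phi> m)"
      using card_image[OF inj[of m]] unfolding image by simp
    finally have less: "count m s < card (W \<phi> m)" .
    have unique: "s' = s" if "listed m s' \<and> count m s' = count m s" for s'
      using that count_less[of m s s'] count_less[of m s' s] s(1) by (metis less_irrefl nat_neq_iff)
    then have "(LEAST s'. listed m s' \<and> count m s' = count m s) = s"
      using s(1) by (intro Least_equality) auto
    then have "E (prod_encode (m, count m s)) = Some x"
      unfolding E_def using s by auto
    with less show ?thesis by blast
  qed
  moreover have "partrec_in {} E"
    unfolding E_def[abs_def] count_def listed_def conv_def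
    by (intro partrec_in_bind partrec_in_search partrec_in_Some rec_intros computable_in_comp[OF F])
  ultimately show ?thesis by blast
qed

section \<open>Bounds for plain complexity\<close>

lemma partial_recursive_machine:
  "machine U \<Longrightarrow> partrec_in {} (\<lambda>n. map_option num_of_str (U (str_of_num n)))"
  by (simp add: machine_def partial_recursive_def)

lemma complexity_le: "U p = Some x \<Longrightarrow> C U x \<le> length p"
  unfolding C_def by (rule Least_le) blast

text \<open>The string of \<open>n\<close> is no longer than \<open>n\<close>, so optimality yields
  a crude bound in \<open>n\<close> itself.\<close>

lemma universal_machine_optimal:
  assumes "universal_machine U" and "partrec_in {} \<psi>"
  shows "\<exists>c. \<forall>n v. \<psi> n = Some v \<longrightarrow> C U (str_of_num v) \<le> n + c"
proof -
  let ?M = "\<lambda>p. map_option str_of_num (\<psi> (num_of_str p))"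
  have "machine ?M"
    using assms(2) by (simp add: machine_def partial_recursive_def option.map_comp comp_def option.map_ident)
  then obtain c where c: "\<And>p x. ?M p = Some x \<Longrightarrow> \<exists>q. U q = Some x \<and> length q \<le> length p + c"
    using assms(1) unfolding universal_machine_def by blast
  have "C U (str_of_num v) \<le> n + c" if *: "\<psi> n = Some v" for n v
  proof -
    obtain q where "U q = Some (str_of_num v)" "length q \<le> length (str_of_num n) + c"
      using c[of "str_of_num n" "str_of_num v"] * by auto
    then show ?thesis
      using complexity_le[of U q] length_str_of_num_le[of n] by fastforce
  qed
  then show ?thesis by blast
qed

text \<open>A lower bound on the \<open>LEAST\<close> in \<open>C\<close> requires some description
  to exist; simulating the identity machine supplies one.\<close>

lemma complexity_ge:
  assumes "universal_machine U" and "\<And>p. U p = Some x \<Longrightarrow> n \<le> length p"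
  shows "n \<le> C U x"
proof -
  have "machine Some"
    using partrec_in_Some[OF computable_in_id] by (simp add: machine_def partial_recursive_def)
  then obtain q where "U q = Some x"
    using assms(1) unfolding universal_machine_def by blast
  then have "\<exists>p. U p = Some x \<and> length p = C U x"
    unfolding C_def by (intro LeastI[of "\<lambda>k. \<exists>p. U p = Some x \<and> length p = k"]) blast
  then obtain p where "U p = Some x" "length p = C U x" by blast
  with assms(2)[of p] show ?thesis by simp
qed

section \<open>The conditions compared with DNR functions\<close>

text \<open>Here \<psi> at \<open>(n, i)\<close> is the diagonal value at \<open>i\<close>, and the
  bound \<open>Suc n\<close> admits \<open>i = n\<close>. Avoidance must hold at every
  \<open>n\<close>, hence \<open>DNR_avoids\<close>.\<close>

lemma DNR_imp_SDNR:
  assumes acc: "acceptable_numbering \<phi>" and "DNR \<phi> f" and "computable_in \<O> f"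
  shows "\<exists>h. computable_in \<O> h \<and> SDNR \<phi> h"
proof -
  have "partrec_in {} (\<lambda>z. \<phi> (pr2 z) (pr2 z))"
    by (rule partrec_in_comp[OF partrec_in_diagonal[OF acc]]) (intro rec_intros)
  moreover have "computable_in {} Suc" by (intro rec_intros)
  ultimately obtain h where "computable_in \<O> h"
      "\<And>n i. i < Suc n \<Longrightarrow> \<phi> i i \<noteq> Some (h n)"
    using DNR_avoids[OF assms, of "\<lambda>z. \<phi> (pr2 z) (pr2 z)" Suc] by auto
  then show ?thesis unfolding SDNR_def by (metis less_Suc_eq_le)
qed

text \<open>The partial functions avoided list the sets \<open>W \<phi> (h n)\<close>; fewer than
  \<open>g n\<close> numbers \<open>i\<close> exhaust such a set.\<close>

lemma DNR_imp_avoids_finite_W: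
  assumes acc: "acceptable_numbering \<phi>" and "DNR \<phi> f" and "computable_in \<O> f"
    and g: "computable_in {} g"
  shows "\<exists>f2. computable_in \<O> f2 \<and>
    (\<forall>h. computable_in {} h \<and> (\<forall>n. finite (W \<phi> (h n)) \<and> card (W \<phi> (h n)) < g n) \<longrightarrow>
      (\<forall>\<^sub>F n in sequentially. f2 n \<notin> W \<phi> (h n)))"
proof -
  obtain E where E: "partrec_in {} E"
    and enum: "\<And>m x. finite (W \<phi> m) \<Longrightarrow> x \<in> W \<phi> m \<Longrightarrow> \<exists>i<card (W \<phi> m). E (prod_encode (m, i)) = Some x"
    using W_enumeration[OF acc] by blast
  obtain f2 where f2: "computable_in \<O> f2"
    and avoid: "\<And>\<psi>. partrec_in {} \<psi> \<Longrightarrow> \<exists>N. \<forall>n\<ge>N. \<forall>i<g n. \<psi> (prod_encode (n, i)) \<noteq> Some (f2 n)"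
    using DNR_avoids_almost_everywhere[OF assms] by blast
  have "\<forall>\<^sub>F n in sequentially. f2 n \<notin> W \<phi> (h n)"
    if h: "computable_in {} h" and small: "\<forall>n. finite (W \<phi> (h n)) \<and> card (W \<phi> (h n)) < g n" for h
  proof -
    have "partrec_in {} (\<lambda>z. E (prod_encode (h (pr1 z), pr2 z)))"
      by (intro partrec_in_comp[OF E] rec_intros computable_in_comp[OF h])
    from avoid[OF this] obtain N where
      N: "\<And>n i. n \<ge> N \<Longrightarrow> i < g n \<Longrightarrow> E (prod_encode (h n, i)) \<noteq> Some (f2 n)" by auto
    have "f2 n \<notin> W \<phi> (h n)" if "n \<ge> N" for n
      using enum[of "h n" "f2 n"] N[OF that] small by (meson less_trans)
    then show ?thesis by (auto simp: eventually_sequentially)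
  qed
  with f2 show ?thesis by blast
qed

lemma avoids_finite_W_imp_DNR:
  assumes acc: "acceptable_numbering \<phi>" and f: "computable_in \<O> f"
    and avoid: "\<And>h. computable_in {} h \<Longrightarrow> (\<And>n. finite (W \<phi> (h n)) \<and> card (W \<phi> (h n)) < 2) \<Longrightarrow>
      \<forall>\<^sub>F n in sequentially. f n \<notin> W \<phi> (h n)"
  shows "\<exists>f'. computable_in \<O> f' \<and> DNR \<phi> f'"
proof -
  \<comment> \<open>The search has a condition independent of \<open>k\<close>: it returns 0 if the
    test \<open>w = pr2 z\<close> holds and diverges otherwise. The resulting set contains at most
    the diagonal value.\<close>
  let ?\<psi> = "\<lambda>z. Option.bind (\<phi> (pr1 z) (pr1 z))
      (\<lambda>w. if \<exists>k::nat. w = pr2 z then Some (LEAST k::nat. w = pr2 z) else None)"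
  have "partrec_in {} ?\<psi>"
    by (intro partrec_in_bind partrec_in_search rec_intros partrec_in_comp[OF partrec_in_diagonal[OF acc]])
  from s_m_n[OF acc this] obtain h where h: "computable_in {} h"
    and \<phi>_h: "\<And>n x. \<phi> (h n) x = ?\<psi> (prod_encode (n, x))" by blast
  have W_h: "W \<phi> (h n) = {v. \<phi> n n = Some v}" for n
    by (auto simp: W_def \<phi>_h Option.bind_eq_Some_conv split: if_splits)
  have "finite (W \<phi> (h n)) \<and> card (W \<phi> (h n)) < 2" for n
    unfolding W_h by (cases "\<phi> n n") auto
  then obtain N where "\<And>n. n \<ge> N \<Longrightarrow> f n \<notin> W \<phi> (h n)"
    using avoid[OF h] by (auto simp: eventually_sequentially)
  then show ?thesis
    unfolding W_h by (intro almost_DNR_imp_DNR[OF f, of N]) blast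
qed

text \<open>Programs shorter than \<open>n\<close> have codes below \<open>2 ^ n\<close>.\<close>

lemma DNR_imp_avoids_short_programs:
  assumes acc: "acceptable_numbering \<phi>" and "DNR \<phi> f" and "computable_in \<O> f"
  shows "\<exists>f3. computable_in \<O> f3 \<and> (\<forall>V. partial_recursive_str_num V \<longrightarrow>
    (\<forall>\<^sub>F n in sequentially. f3 n \<notin> {v. \<exists>p. length p < n \<and> V p = Some v}))"
proof -
  have "computable_in {} (\<lambda>n. 2 ^ n)" by (intro rec_intros)
  then obtain f3 where f3: "computable_in \<O> f3"
    and avoid: "\<And>\<psi>. partrec_in {} \<psi> \<Longrightarrow> \<exists>N. \<forall>n\<ge>N. \<forall>i<2 ^ n. \<psi> (prod_encode (n, i)) \<noteq> Some (f3 n)"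
    using DNR_avoids_almost_everywhere[OF assms] by blast
  have "\<forall>\<^sub>F n in sequentially. f3 n \<notin> {v. \<exists>p. length p < n \<and> V p = Some v}"
    if V: "partial_recursive_str_num V" for V
  proof -
    have "partrec_in {} (\<lambda>n. V (str_of_num n))"
      using V by (simp add: partial_recursive_str_num_def partial_recursive_def)
    then have "partrec_in {} (\<lambda>z. V (str_of_num (pr2 z)))"
      by (rule partrec_in_comp) (intro rec_intros)
    from avoid[OF this] obtain N where
      N: "\<And>n i. n \<ge> N \<Longrightarrow> i < 2 ^ n \<Longrightarrow> V (str_of_num i) \<noteq> Some (f3 n)" by auto
    have "V p \<noteq> Some (f3 n)" if "n \<ge> N" "length p < n" for n p
      using N[OF that(1) num_of_str_less[OF that(2)]] by simp
    then show ?thesis by (auto simp: eventually_sequentially)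
  qed
  with f3 show ?thesis by blast
qed

text \<open>\<open>V\<close> reads its program as a number and computes the diagonal there. The
  string of \<open>n\<close> has length at most \<open>n\<close>, hence the shift to
  \<open>Suc n\<close>.\<close>

lemma avoids_short_programs_imp_DNR:
  assumes acc: "acceptable_numbering \<phi>" and f: "computable_in \<O> f"
    and avoid: "\<And>V. partial_recursive_str_num V \<Longrightarrow>
      \<forall>\<^sub>F n in sequentially. f n \<notin> {v. \<exists>p. length p < n \<and> V p = Some v}"
  shows "\<exists>f'. computable_in \<O> f' \<and> DNR \<phi> f'"
proof -
  have "partial_recursive_str_num (\<lambda>p. \<phi> (num_of_str p) (num_of_str p))"
    using partrec_in_diagonal[OF acc]
    by (simp add: partial_recursive_str_num_def partial_recursive_def)
  from avoid[OF this] obtain N where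
    N: "\<And>n p v. n \<ge> N \<Longrightarrow> length p < n \<Longrightarrow> \<phi> (num_of_str p) (num_of_str p) = Some v \<Longrightarrow> f n \<noteq> v"
    by (auto simp: eventually_sequentially)
  have "f (Suc n) \<noteq> v" if "n \<ge> N" "\<phi> n n = Some v" for n v
    using N[of "Suc n" "str_of_num n" v] that length_str_of_num_le[of n] by simp
  then show ?thesis
    by (intro almost_DNR_imp_DNR[of \<O> "\<lambda>n. f (Suc n)" N] computable_in_comp[OF f] rec_intros)
qed

text \<open>A diagonal value at \<open>n\<close> has complexity at most \<open>n + c\<close>, too
  little for \<open>f (Suc (n + c))\<close>.\<close>

lemma complex_imp_DNR:
  assumes acc: "acceptable_numbering \<phi>" and U: "universal_machine U"
    and f: "computable_in \<O> f" and complex: "\<And>n. n \<le> C U (str_of_num (f n))"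
  shows "\<exists>f'. computable_in \<O> f' \<and> DNR \<phi> f'"
proof -
  obtain c where c: "\<And>n v. \<phi> n n = Some v \<Longrightarrow> C U (str_of_num v) \<le> n + c"
    using universal_machine_optimal[OF U partrec_in_diagonal[OF acc]] by blast
  have "DNR \<phi> (\<lambda>n. f (Suc (n + c)))"
    unfolding DNR_def using c complex by (metis not_less_eq_eq)
  moreover have "computable_in \<O> (\<lambda>n. f (Suc (n + c)))"
    by (intro computable_in_comp[OF f] rec_intros)
  ultimately show ?thesis by blast
qed

lemma turing_le_iff: "f \<le>\<^sub>T A \<longleftrightarrow> computable_in {char_fun A} f"
  by (simp add: turing_le_def computable_in_def)

lemma autocomplex_imp_complex:
  assumes "autocomplex U A"
  shows "\<exists>f. f \<le>\<^sub>T A \<and> (\<forall>n. n \<le> C U (str_of_num (f n)))"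
proof -
  obtain g where g: "computable_in {char_fun A} g" and unbounded: "\<And>b. \<exists>y. g y > b"
    and le: "\<And>y. g y \<le> C U (A \<restriction> y)"
    using assms unfolding autocomplex_def turing_le_iff by blast
  define y where "y n = (LEAST y. n \<le> g y)" for n
  have ex: "\<exists>y. n \<le> g y" for n using unbounded[of n] by (auto intro: less_imp_le)
  have "computable_in {char_fun A} y"
    unfolding y_def[abs_def]
    by (rule computable_in_Least) (intro rec_intros computable_in_comp[OF g], rule ex)
  then have "(\<lambda>n. segment_code A (y n)) \<le>\<^sub>T A"
    unfolding turing_le_iff by (rule computable_in_comp[OF computable_in_segment_code])
  moreover have "n \<le> C U (str_of_num (segment_code A (y n)))" for n
    using LeastI_ex[OF ex[of n]] le[of "y n"] unfolding y_def by simp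
  ultimately show ?thesis by blast
qed

text \<open>If \<open>f\<close> avoids \<open>\<psi> (n, i) = F (n, U i)\<close>, where \<open>F\<close> approximates \<open>f\<close>, then \<open>F\<close> converging on
  \<open>(n, A \<restriction> y)\<close> shows that \<open>A \<restriction> y\<close> has no description shorter than \<open>n\<close>.\<close>

lemma DNR_imp_autocomplex:
  assumes acc: "acceptable_numbering \<phi>" and U: "universal_machine U"
    and "DNR \<phi> f0" and "f0 \<le>\<^sub>T A"
  shows "autocomplex U A"
proof -
  have "computable_in {} (\<lambda>n. 2 ^ n)" by (intro rec_intros)
  then obtain f where f: "computable_in {char_fun A} f"
    and avoid: "\<And>\<psi>. partrec_in {} \<psi> \<Longrightarrow> \<exists>N. \<forall>n\<ge>N. \<forall>i<2 ^ n. \<psi> (prod_encode (n, i)) \<noteq> Some (f n)"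
    using DNR_avoids_almost_everywhere[OF acc assms(3) assms(4)[unfolded turing_le_iff]] by blast
  obtain F where F: "computable_in {} F" and approx: "approximates (segment_code A) F (\<lambda>n. Some (f n))"
    using oracle_approximation[OF partrec_in_Some[OF f]] by blast
  define conv where "conv n y \<longleftrightarrow> F (prod_encode (n, segment_code A y)) \<noteq> 0" for n y
  have conv_value: "F (prod_encode (n, segment_code A y)) = Suc (f n)" if "conv n y" for n y
    using that approximates_sound[OF approx, of n y] unfolding conv_def
    by (metis not0_implies_Suc option.inject)
  have conv_mono: "conv n y'" if "conv n y" "y \<le> y'" for n y y'
    using approximates_mono[OF approx conv_value[OF that(1)] that(2)] unfolding conv_def by simp
  have conv_ex: "\<exists>y. conv n y" for n
    using approximates_complete[OF approx, of n "f n"] unfolding conv_def by (metis nat.distinct(1))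
  \<comment> \<open>Subtracting 1 undoes the \<open>Suc\<close> of the approximation. A report of 0
    yields the value 0, which merely forbids one more value.\<close>
  have "partrec_in {} (\<lambda>z. Option.bind (map_option num_of_str (U (str_of_num (pr2 z))))
      (\<lambda>s. Some (F (prod_encode (pr1 z, s)) - 1)))"
    using U unfolding universal_machine_def
    by (intro partrec_in_bind partrec_in_Some rec_intros computable_in_comp[OF F]
        partrec_in_comp[OF partial_recursive_machine]) auto
  from avoid[OF this] obtain N where
    N: "\<And>n i s. n \<ge> N \<Longrightarrow> i < 2 ^ n \<Longrightarrow> U (str_of_num i) = Some s \<Longrightarrow>
      F (prod_encode (n, num_of_str s)) - 1 \<noteq> f n"
    by fastforce
  have complex: "n \<le> C U (A \<restriction> y)" if "conv n y" "n \<ge> N" for n y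
  proof (rule complexity_ge[OF U], rule ccontr)
    fix p assume "U p = Some (A \<restriction> y)" and "\<not> n \<le> length p"
    then show False
      using N[OF that(2) num_of_str_less, of p "A \<restriction> y"] conv_value[OF that(1)]
      by (simp add: segment_code_def)
  qed
  \<comment> \<open>All \<open>n < k y\<close> have converged on the segment of length
    \<open>y\<close>; the cap \<open>y \<le> n\<close> makes the search total.\<close>
  define k where "k y = (LEAST n. y \<le> n \<or> \<not> conv n y)" for y
  have conv_k: "conv n y" if "n < k y" for n y
    using that not_less_Least unfolding k_def by blast
  have k_stop: "y \<le> k y \<or> \<not> conv (k y) y" for y
    unfolding k_def by (rule LeastI[of _ y]) simp
  have k_ge: "m \<le> k y" if "\<And>n. n < m \<Longrightarrow> n < y \<and> conv n y" for m y
    using that[of "k y"] k_stop[of y] by linarith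
  have k_le: "k y \<le> y" for y
    unfolding k_def by (rule Least_le) simp
  \<comment> \<open>The largest certified number is \<open>k y - 1\<close>, and it counts only from
    \<open>N\<close> on; truncated subtraction makes the remaining cases trivial.\<close>
  have "k y - Suc N \<le> C U (A \<restriction> y)" for y
  proof (cases "k y \<le> Suc N")
    case False
    then have "k y - 1 \<le> C U (A \<restriction> y)"
      by (intro complex conv_k) auto
    then show ?thesis by linarith
  qed simp
  moreover have "mono (\<lambda>y. k y - Suc N)"
  proof (intro monoI diff_le_mono k_ge conjI)
    fix y y' n assume "y \<le> y'" and "n < k y"
    then show "n < y'" using k_le[of y] by linarith
    show "conv n y'" using conv_mono[OF conv_k[OF \<open>n < k y\<close>] \<open>y \<le> y'\<close>] .
  qed
  moreover have "\<exists>y. k y - Suc N > b" for b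
  proof -
    obtain Y where Y: "\<And>n. conv n (Y n)" using conv_ex by metis
    define m where "m = N + b + 2"
    \<comment> \<open>This length exceeds the convergence stages of all \<open>n < m\<close> and
      also meets the cap in \<open>k\<close>.\<close>
    define y where "y = Max (insert m (Y ` {..<m}))"
    have "m \<le> y" unfolding y_def by (rule Max_ge) auto
    moreover have "conv n y" if "n < m" for n
      using that unfolding y_def by (intro conv_mono[OF Y] Max_ge) auto
    ultimately have "m \<le> k y" by (intro k_ge) auto
    then show ?thesis unfolding m_def by (intro exI[of _ y]) linarith
  qed
  moreover have "(\<lambda>y. k y - Suc N) \<le>\<^sub>T A"
  proof -
    have "computable_in {char_fun A} k"
      unfolding k_def[abs_def] conv_def
      by (rule computable_in_Least)
        (intro rec_intros computable_in_comp[OF computable_in_mono[OF F]]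
          computable_in_comp[OF computable_in_segment_code], blast)
    then show ?thesis unfolding turing_le_iff by (intro rec_intros)
  qed
  ultimately show ?thesis unfolding autocomplex_def by blast
qed


theorem theorem2p7:
  fixes \<phi> :: "nat \<Rightarrow> nat \<Rightarrow> nat option"
    and U :: "bool list \<Rightarrow> bool list option"
    and A :: "nat set"
  assumes "acceptable_numbering \<phi>"
    and "universal_machine U"
  shows "let
      c1 = (\<exists>f\<^sub>1. f\<^sub>1 \<le>\<^sub>T A \<and> SDNR \<phi> f\<^sub>1);
      c2 = (\<forall>g. recursive g \<longrightarrow>
              (\<exists>f\<^sub>2. f\<^sub>2 \<le>\<^sub>T A \<and>
                (\<forall>h. recursive h \<and> (\<forall>n. finite (W \<phi> (h n)) \<and> card (W \<phi> (h n)) < g n) \<longrightarrow>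
                  (\<forall>\<^sub>F n in sequentially. f\<^sub>2 n \<notin> W \<phi> (h n)))));
      c3 = (\<exists>f\<^sub>3. f\<^sub>3 \<le>\<^sub>T A \<and>
              (\<forall>V. partial_recursive_str_num V \<longrightarrow>
                (\<forall>\<^sub>F n in sequentially. f\<^sub>3 n \<notin> {v. \<exists>p. length p < n \<and> V p = Some v})));
      c4 = (\<exists>f\<^sub>4. f\<^sub>4 \<le>\<^sub>T A \<and> (\<forall>n. C U (str_of_num (f\<^sub>4 n)) \<ge> n));
      c5 = (\<exists>f\<^sub>5. f\<^sub>5 \<le>\<^sub>T A \<and> DNR \<phi> f\<^sub>5);
      c6 = autocomplex U A
    in (c1 \<longleftrightarrow> c2) \<and> (c2 \<longleftrightarrow> c3) \<and> (c3 \<longleftrightarrow> c4) \<and> (c4 \<longleftrightarrow> c5) \<and> (c5 \<longleftrightarrow> c6)"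
  (is "let c1 = ?c1; c2 = ?c2; c3 = ?c3; c4 = ?c4; c5 = ?c5; c6 = ?c6 in _")
proof -
  have rec: "recursive g \<longleftrightarrow> computable_in {} g" for g
    by (simp add: recursive_def partial_recursive_def computable_in_def)
  have "?c5 \<Longrightarrow> ?c1"
    using DNR_imp_SDNR[OF assms(1)] unfolding turing_le_iff by blast
  moreover have "?c1 \<Longrightarrow> ?c5"
    unfolding SDNR_def DNR_def by blast
  moreover have "?c5 \<Longrightarrow> ?c2"
    using DNR_imp_avoids_finite_W[OF assms(1)] unfolding turing_le_iff rec by blast
  moreover have "?c5" if c2: "?c2"
  proof -
    \<comment> \<open>The constant bound 2 restricts condition (2) to sets with at most one
      element.\<close>
    have "computable_in {} (\<lambda>_. 2)" by (intro rec_intros)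
    with c2 show ?thesis
      using avoids_finite_W_imp_DNR[OF assms(1)] unfolding turing_le_iff rec by blast
  qed
  moreover have "?c5 \<Longrightarrow> ?c3"
    using DNR_imp_avoids_short_programs[OF assms(1)] unfolding turing_le_iff by blast
  moreover have "?c3 \<Longrightarrow> ?c5"
    using avoids_short_programs_imp_DNR[OF assms(1)] unfolding turing_le_iff by blast
  \<comment> \<open>Conditions (5), (6) and (4) are linked in a cycle, while (1), (2) and (3) are
    each tied to (5) in both directions.\<close>
  moreover have "?c4 \<Longrightarrow> ?c5"
    using complex_imp_DNR[OF assms] unfolding turing_le_iff by blast
  moreover have "?c5 \<Longrightarrow> ?c6"
    using DNR_imp_autocomplex[OF assms] by blast
  moreover have "?c6 \<Longrightarrow> ?c4"
    by (rule autocomplex_imp_complex)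
  ultimately show ?thesis
    unfolding Let_def by argo
qed

end
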